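(* Let $1\le k\le n$ with $2k\ge n$. The forest $M_n^k$ consisting of $n-k$ copies of $P_2$ and $2k-n$ isolated vertices $K_1$ is the unique forest in $\mathcal{F}_n^k$ with maximum energy, and its energy is $2(n-k)$.
   Context: $\mathcal{F}_n^k$ denotes the set of (simple, unweighted) forests with $n$ vertices and exactly $k$ connected components. $P_j$ denotes the path on $j$ vertices. The energy of a graph is the sum of the absolute values of the eigenvalues of its adjacency matrix. Uniqueness is up to isomorphism. *)

theory Defs
  imports
    "Graph_Theory.Graph_Theory"
    "Jordan_Normal_Form.Spectral_Radius"
begin

text \<open>
  A finite simple graph is a \<^locale>\<open>pair_graph\<close>: a finite, loop-free digraph whose arc set
  \<^const>\<open>parcs\<close> is a symmetric relation. Its isomorphisms are those of \<^const>\<open>digraph_iso\<close>.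
\<close>

subsection \<open>Forests\<close>

text \<open>
  In a symmetric digraph every edge gives a closed walk \<open>a, b, a\<close> which the library counts as
  a cycle, so the library constant \<^const>\<open>forest\<close> would only admit edgeless graphs. The cycles of the
  underlying undirected graph are exactly those of length at least three.
\<close>

definition acyclic_graph :: "'a pair_pre_digraph \<Rightarrow> bool" where
  "acyclic_graph G \<longleftrightarrow> \<not> (\<exists>p. pre_digraph.cycle (with_proj G) p \<and> 3 \<le> length p)"

text \<open>
  As the arc relation is symmetric, the strongly connected components are the connected
  components of the undirected graph.
\<close>

definition forests :: "nat \<Rightarrow> nat \<Rightarrow> 'a pair_pre_digraph set" where
  "forests n k = {G. pair_graph G \<and> acyclic_graph G \<and> card (pverts G) = n \<and>
     card (pre_digraph.sccs (with_proj G)) = k}"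

subsection \<open>Paths and disjoint unions\<close>

definition path_graph :: "nat \<Rightarrow> nat pair_pre_digraph" where
  "path_graph j = \<lparr>pverts = {..<j},
     parcs = {(u, v). u < j \<and> v < j \<and> (v = Suc u \<or> u = Suc v)}\<rparr>"

definition disjoint_union_graph ::
  "'i set \<Rightarrow> ('i \<Rightarrow> 'a pair_pre_digraph) \<Rightarrow> ('i \<times> 'a) pair_pre_digraph" where
  "disjoint_union_graph I H = \<lparr>pverts = (SIGMA i:I. pverts (H i)),
     parcs = {((i, u), (i, v)) | i u v. i \<in> I \<and> (u, v) \<in> parcs (H i)}\<rparr>"

text \<open>
  The forest \<open>M\<^sub>n\<^sup>k\<close>: \<open>n - k\<close> copies of \<open>P\<^sub>2\<close> and \<open>2k - n\<close> copies of \<open>K\<^sub>1 = P\<^sub>1\<close>.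
  The subtractions are on natural numbers, hence meaningful only for \<open>k \<le> n \<le> 2k\<close>.
\<close>

definition matching_forest :: "nat \<Rightarrow> nat \<Rightarrow> (nat \<times> nat) pair_pre_digraph" where
  "matching_forest n k = disjoint_union_graph {..<(n - k) + (2 * k - n)}
     (\<lambda>i. if i < n - k then path_graph 2 else path_graph 1)"

subsection \<open>Energy\<close>

definition adjacency_mat :: "'a pair_pre_digraph \<Rightarrow> 'a list \<Rightarrow> complex mat" where
  "adjacency_mat G vs = mat (length vs) (length vs)
     (\<lambda>(i, j). if (vs ! i, vs ! j) \<in> parcs G then 1 else 0)"

text \<open>
  The eigenvalues are counted with multiplicity. They are taken over the complex numbers, so that
  none is lost; for the symmetric real matrices considered here they are all real.
\<close>

definition mat_energy :: "complex mat \<Rightarrow> real" where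
  "mat_energy A = (\<Sum>x\<in>spectrum A. real (order x (char_poly A)) * cmod x)"

text \<open>
  The vertices are listed in an arbitrary order to form the matrix; the lemma \<open>graph_energy_eq\<close>
  below shows that the energy does not depend on this order.
\<close>

definition graph_energy :: "'a pair_pre_digraph \<Rightarrow> real" where
  "graph_energy G =
     mat_energy (adjacency_mat G (SOME vs. distinct vs \<and> set vs = pverts G))"

lemma mat_energy_similar:
  assumes "similar_mat A B"
  shows "mat_energy A = mat_energy B"
proof -
  obtain n where A: "A \<in> carrier_mat n n" and B: "B \<in> carrier_mat n n"
    using similar_matD[OF assms] by auto
  have c: "char_poly A = char_poly B"
    using assms by (rule char_poly_similar)
  have "spectrum A = spectrum B"
    using spectrum_root_char_poly[OF A] spectrum_root_char_poly[OF B] c by simp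
  then show ?thesis
    unfolding mat_energy_def c by simp
qed

lemma similar_adjacency_mat:
  assumes "distinct vs" "distinct ws" "set vs = set ws"
  shows "similar_mat (adjacency_mat G vs) (adjacency_mat G ws)"
proof -
  define n where "n = length vs"
  have nw: "length ws = n"
    unfolding n_def using assms by (metis distinct_card)
  have nv: "length vs = n"
    by (simp add: n_def)
  define P :: "complex mat" where "P = mat n n (\<lambda>(i, j). if vs ! i = ws ! j then 1 else 0)"
  define Q :: "complex mat" where "Q = mat n n (\<lambda>(i, j). if ws ! i = vs ! j then 1 else 0)"
  have P: "P \<in> carrier_mat n n" and Q: "Q \<in> carrier_mat n n"
    by (auto simp: P_def Q_def)
  have "\<exists>p. \<forall>i<n. p i < n \<and> ws ! p i = vs ! i"
  proof -
    have "\<forall>i. \<exists>j. i < n \<longrightarrow> j < n \<and> ws ! j = vs ! i"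
      using assms(3) nv nw by (metis in_set_conv_nth nth_mem)
    then show ?thesis by metis
  qed
  then obtain p where p: "\<And>i. i < n \<Longrightarrow> p i < n" "\<And>i. i < n \<Longrightarrow> ws ! p i = vs ! i" by blast
  have "\<exists>q. \<forall>i<n. q i < n \<and> vs ! q i = ws ! i"
  proof -
    have "\<forall>i. \<exists>j. i < n \<longrightarrow> j < n \<and> vs ! j = ws ! i"
      using assms(3) nv nw by (metis in_set_conv_nth nth_mem)
    then show ?thesis by metis
  qed
  then obtain q where q: "\<And>i. i < n \<Longrightarrow> q i < n" "\<And>i. i < n \<Longrightarrow> vs ! q i = ws ! i" by blast
  have eqP: "vs ! i = ws ! j \<longleftrightarrow> j = p i" if "i < n" "j < n" for i j
    using that p[of i] assms(2) nw by (metis nth_eq_iff_index_eq)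
  have eqQ: "ws ! i = vs ! j \<longleftrightarrow> j = q i" if "i < n" "j < n" for i j
    using that q[of i] assms(1) nv by (metis nth_eq_iff_index_eq)
  have mulP: "P * X = mat n n (\<lambda>(i, j). X $$ (p i, j))" if X: "X \<in> carrier_mat n n" for X
  proof (rule eq_matI)
    fix i j assume "i < dim_row (mat n n (\<lambda>(i, j). X $$ (p i, j)))"
      "j < dim_col (mat n n (\<lambda>(i, j). X $$ (p i, j)))"
    then have ij: "i < n" "j < n" by auto
    have "(P * X) $$ (i, j) = (\<Sum>l<n. (if vs ! i = ws ! l then 1 else 0) * X $$ (l, j))"
      using ij X by (simp add: P_def scalar_prod_def atLeast0LessThan)
    also have "\<dots> = (\<Sum>l<n. if l = p i then X $$ (l, j) else 0)"
      using ij by (intro sum.cong) (auto simp: eqP)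
    also have "\<dots> = X $$ (p i, j)"
      using p(1)[OF ij(1)] by simp
    finally show "(P * X) $$ (i, j) = mat n n (\<lambda>(i, j). X $$ (p i, j)) $$ (i, j)"
      using ij by simp
  qed (use X in \<open>auto simp: P_def\<close>)
  have mulQ: "Q * X = mat n n (\<lambda>(i, j). X $$ (q i, j))" if X: "X \<in> carrier_mat n n" for X
  proof (rule eq_matI)
    fix i j assume "i < dim_row (mat n n (\<lambda>(i, j). X $$ (q i, j)))"
      "j < dim_col (mat n n (\<lambda>(i, j). X $$ (q i, j)))"
    then have ij: "i < n" "j < n" by auto
    have "(Q * X) $$ (i, j) = (\<Sum>l<n. (if ws ! i = vs ! l then 1 else 0) * X $$ (l, j))"
      using ij X by (simp add: Q_def scalar_prod_def atLeast0LessThan)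
    also have "\<dots> = (\<Sum>l<n. if l = q i then X $$ (l, j) else 0)"
      using ij by (intro sum.cong) (auto simp: eqQ)
    also have "\<dots> = X $$ (q i, j)"
      using q(1)[OF ij(1)] by simp
    finally show "(Q * X) $$ (i, j) = mat n n (\<lambda>(i, j). X $$ (q i, j)) $$ (i, j)"
      using ij by simp
  qed (use X in \<open>auto simp: Q_def\<close>)
  have PQ: "P * Q = 1\<^sub>m n"
    unfolding mulP[OF Q] using p assms(1) nv
    by (intro eq_matI) (auto simp: Q_def nth_eq_iff_index_eq)
  have QP: "Q * P = 1\<^sub>m n"
    unfolding mulQ[OF P] using q assms(2) nw
    by (intro eq_matI) (auto simp: P_def nth_eq_iff_index_eq)
  let ?A = "adjacency_mat G vs" and ?B = "adjacency_mat G ws"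
  have A: "?A \<in> carrier_mat n n" and B: "?B \<in> carrier_mat n n"
    by (auto simp: adjacency_mat_def nv nw)
  have "?A * P = P * ?B"
  proof (rule eq_matI)
    fix i j assume "i < dim_row (P * ?B)" "j < dim_col (P * ?B)"
    then have ij: "i < n" "j < n" using P B by auto
    have eqP': "vs ! l = ws ! j \<longleftrightarrow> l = q j" if "l < n" for l
      using eqQ[OF ij(2) that] by auto
    have "(?A * P) $$ (i, j) = (\<Sum>l<n. ?A $$ (i, l) * (if vs ! l = ws ! j then 1 else 0))"
      using ij A by (simp add: P_def scalar_prod_def atLeast0LessThan)
    also have "\<dots> = (\<Sum>l<n. if l = q j then ?A $$ (i, l) else 0)"
      using ij by (intro sum.cong) (auto simp: eqP')
    also have "\<dots> = ?A $$ (i, q j)"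
      using q(1)[OF ij(2)] by simp
    also have "\<dots> = ?B $$ (p i, j)"
      using ij p q by (simp add: adjacency_mat_def nv nw)
    finally show "(?A * P) $$ (i, j) = (P * ?B) $$ (i, j)"
      using ij mulP[OF B] by simp
  qed (use P A B in auto)
  then have "?A * P * Q = P * ?B * Q"
    by simp
  then have "?A = P * ?B * Q"
    using A P Q PQ by (simp add: assoc_mult_mat[OF A P Q])
  then show ?thesis
    unfolding similar_mat_def similar_mat_wit_def Let_def
    using A B P Q PQ QP by (intro exI[of _ P] exI[of _ Q]) auto
qed

lemma graph_energy_eq:
  assumes "distinct vs" "set vs = pverts G"
  shows "graph_energy G = mat_energy (adjacency_mat G vs)"
proof -
  let ?ws = "SOME ws. distinct ws \<and> set ws = pverts G"
  have "distinct ?ws \<and> set ?ws = pverts G"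
    using assms by (intro someI[of "\<lambda>ws. distinct ws \<and> set ws = pverts G" vs]) simp
  then show ?thesis
    unfolding graph_energy_def
    using assms by (intro mat_energy_similar similar_adjacency_mat) auto
qed

end

theory Submission
  imports Defs
begin

text \<open>
  Let \<open>G\<close> have \<open>m\<close> edges and \<open>s\<close> non-isolated vertices. Isolated vertices only contribute zero
  eigenvalues, so at most \<open>s\<close> eigenvalues \<open>\<lambda>\<close> matter, and each of them satisfies
  \<open>2\<bar>\<lambda>\<bar> \<le> 1 + \<lambda>\<^sup>2\<close>. As the squares of the eigenvalues sum to the trace \<open>2m\<close> of \<open>A\<^sup>2\<close>, twice the
  energy is at most \<open>s + 2m \<le> 4m\<close>, and in a forest \<open>m \<le> n - k\<close>. Equality forces \<open>s = 2m\<close>, that is,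
  all degrees are at most one. Conversely, if all degrees are at most one, then the eigenvalues
  on the non-isolated vertices are \<open>\<plusminus>1\<close>, so the energy is \<open>2m\<close>.
\<close>

subsection \<open>Eigenvalues with multiplicity\<close>

text \<open>Translates the multiplicity \<open>order\<close> into a count of list entries, so that
  eigenvalues can be treated as a list \<open>es\<close> with repetitions.\<close>

lemma order_prod_list_linear:
  fixes es :: "'a :: idom list"
  shows "order x (\<Prod>e\<leftarrow>es. [:- e, 1:]) = count_list es x"
proof (induction es)
  case (Cons e es)
  have "(\<Prod>e\<leftarrow>es. [:- e, 1:]) \<noteq> (0 :: 'a poly)"
    by (auto simp: prod_list_zero_iff)
  then have "order x (\<Prod>e\<leftarrow>e # es. [:- e, 1:]) = order x [:- e, 1:] + count_list es x"
    using Cons.IH by (simp add: order_mult del: mult_pCons_left)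
  moreover have "order x [:- e, 1:] = (if e = x then 1 else 0)"
    using order_power_n_n[of x 1] by (auto intro: order_0I)
  ultimately show ?case by simp
qed (simp add: order_0I)

lemma sum_list_eq_sum_count_list:
  fixes f :: "'a \<Rightarrow> 'b :: comm_semiring_1"
  shows "(\<Sum>x\<leftarrow>xs. f x) = (\<Sum>x\<in>set xs. of_nat (count_list xs x) * f x)"
proof -
  \<comment> \<open>The index set is a fixed finite \<open>X\<close> because \<open>set xs\<close>
    would change in the induction step.\<close>
  have "(\<Sum>x\<leftarrow>xs. f x) = (\<Sum>x\<in>X. of_nat (count_list xs x) * f x)" if "finite X" "set xs \<subseteq> X" for X
    using that
  proof (induction xs)
    case (Cons a xs)
    have "(\<Sum>x\<in>X. of_nat (count_list (a # xs) x) * f x) =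
        (\<Sum>x\<in>X. (if x = a then f x else 0) + of_nat (count_list xs x) * f x)"
      by (intro sum.cong) (auto simp: algebra_simps)
    also have "\<dots> = f a + (\<Sum>x\<in>X. of_nat (count_list xs x) * f x)"
      using Cons.prems by (simp add: sum.distrib)
    finally show ?case
      using Cons by simp
  qed simp
  then show ?thesis by simp
qed

lemma mat_energy_eq_sum_list:
  assumes A: "A \<in> carrier_mat n n" and c: "char_poly A = (\<Prod>e\<leftarrow>es. [:- e, 1:])"
  shows "mat_energy A = (\<Sum>e\<leftarrow>es. cmod e)"
proof -
  have "spectrum A = set es"
    unfolding spectrum_root_char_poly[OF A] c by (auto simp: poly_prod_list prod_list_zero_iff)
  then show ?thesis
    unfolding mat_energy_def c order_prod_list_linear by (simp add: sum_list_eq_sum_count_list)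
qed

section \<open>Trace of the square and its eigenvalues\<close>

lemma sum_diag_mult_commute:
  fixes A B :: "'a :: comm_ring_1 mat"
  assumes A: "A \<in> carrier_mat n m" and B: "B \<in> carrier_mat m n"
  shows "(\<Sum>i<n. (A * B) $$ (i, i)) = (\<Sum>j<m. (B * A) $$ (j, j))"
proof -
  have "(\<Sum>i<n. (A * B) $$ (i, i)) = (\<Sum>i<n. \<Sum>j<m. A $$ (i, j) * B $$ (j, i))"
    using A B by (intro sum.cong) (auto simp: scalar_prod_def atLeast0LessThan)
  also have "\<dots> = (\<Sum>j<m. \<Sum>i<n. B $$ (j, i) * A $$ (i, j))"
    by (subst sum.swap) (simp add: mult.commute)
  also have "\<dots> = (\<Sum>j<m. (B * A) $$ (j, j))"
    using A B by (intro sum.cong) (auto simp: scalar_prod_def atLeast0LessThan)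
  finally show ?thesis .
qed

text \<open>Schur decomposition makes \<open>A\<close> similar to an upper triangular
  \<open>B\<close> with diagonal \<open>es\<close>. The trace of a square is invariant under
  similarity, and the diagonal of \<open>B * B\<close> consists of the squares of the diagonal
  entries of \<open>B\<close>.\<close>

lemma sum_diag_square_eq_sum_eigenvalues:
  fixes A :: "complex mat"
  assumes A: "A \<in> carrier_mat n n" and c: "char_poly A = (\<Prod>e\<leftarrow>es. [:- e, 1:])"
  shows "(\<Sum>i<n. (A * A) $$ (i, i)) = (\<Sum>e\<leftarrow>es. e\<^sup>2)"
proof -
  obtain B P Q where S: "schur_decomposition A es = (B, P, Q)"
    by (cases "schur_decomposition A es") auto
  from schur_decomposition[OF A c S]
  have wit: "similar_mat_wit A B P Q" and ut: "upper_triangular B" and diag: "diag_mat B = es"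
    by auto
  from similar_mat_witD2[OF A wit] have B: "B \<in> carrier_mat n n" and P: "P \<in> carrier_mat n n"
    and Q: "Q \<in> carrier_mat n n" and QP: "Q * P = 1\<^sub>m n" and AB: "A = P * B * Q"
    by auto
  have "similar_mat_wit (A * A) (B * B) P Q"
    using similar_mat_wit_pow[OF wit, of 2] A B by (simp add: numeral_2_eq_2)
  then have AA: "A * A = P * (B * B) * Q"
    by (simp add: similar_mat_wit_def Let_def)
  \<comment> \<open>Exchanging the factors under the trace brings \<open>Q\<close> next to
    \<open>P\<close>, where the two cancel.\<close>
  have "(\<Sum>i<n. (A * A) $$ (i, i)) = (\<Sum>i<n. (Q * (P * (B * B))) $$ (i, i))"
    unfolding AA by (rule sum_diag_mult_commute) (use P Q B in auto)
  also have "Q * (P * (B * B)) = B * B"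
    using assoc_mult_mat[OF Q P, of "B * B" n] B QP by simp
  also have "(\<Sum>i<n. (B * B) $$ (i, i)) = (\<Sum>i<n. (B $$ (i, i))\<^sup>2)"
  proof (rule sum.cong[OF refl])
    fix i assume i: "i \<in> {..<n}"
    have "(B * B) $$ (i, i) = (\<Sum>j<n. B $$ (i, j) * B $$ (j, i))"
      using i B by (auto simp: scalar_prod_def atLeast0LessThan)
    also have "\<dots> = (\<Sum>j<n. if j = i then (B $$ (i, i))\<^sup>2 else 0)"
    proof (rule sum.cong[OF refl])
      fix j assume j: "j \<in> {..<n}"
      \<comment> \<open>For \<open>i \<noteq> j\<close> one of the two positions lies below the
        diagonal, where \<open>B\<close> vanishes.\<close>
      show "B $$ (i, j) * B $$ (j, i) = (if j = i then (B $$ (i, i))\<^sup>2 else 0)"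
        using upper_triangularD[OF ut, of j i] upper_triangularD[OF ut, of i j] i j B
        by (cases i j rule: linorder_cases) (auto simp: power2_eq_square)
    qed
    also have "\<dots> = (B $$ (i, i))\<^sup>2"
      using i by simp
    finally show "(B * B) $$ (i, i) = (B $$ (i, i))\<^sup>2" .
  qed
  also have "\<dots> = (\<Sum>e\<leftarrow>diag_mat B. e\<^sup>2)"
    using B by (simp add: diag_mat_def comp_def interv_sum_list_conv_sum_set_nat atLeast0LessThan)
  finally show ?thesis unfolding diag .
qed

text \<open>For an eigenvector \<open>v\<close>, the Hermitian form \<open>q\<close> of
  \<open>A\<close> at \<open>v\<close> equals its own conjugate and also \<open>e\<close> times the
  squared norm \<open>s\<close> of \<open>v\<close>; since \<open>s \<noteq> 0\<close>,
  \<open>e\<close> equals its conjugate.\<close>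

lemma hermitian_eigenvalue_real:
  fixes A :: "complex mat"
  assumes A: "A \<in> carrier_mat n n"
    and herm: "\<And>i j. i < n \<Longrightarrow> j < n \<Longrightarrow> A $$ (j, i) = cnj (A $$ (i, j))"
    and e: "eigenvalue A e"
  shows "e \<in> \<real>"
proof -
  from e obtain v where v: "v \<in> carrier_vec n" "v \<noteq> 0\<^sub>v n" and Av: "A *\<^sub>v v = e \<cdot>\<^sub>v v"
    unfolding eigenvalue_def eigenvector_def using A by auto
  have Av_i: "(\<Sum>j<n. A $$ (i, j) * v $ j) = e * v $ i" if "i < n" for i
    using arg_cong[OF Av, of "\<lambda>w. w $ i"] that A v by (simp add: scalar_prod_def atLeast0LessThan)
  define q where "q = (\<Sum>i<n. \<Sum>j<n. cnj (v $ i) * (A $$ (i, j) * v $ j))"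
  define s where "s = (\<Sum>i<n. (cmod (v $ i))\<^sup>2)"
  have "q = (\<Sum>i<n. cnj (v $ i) * (e * v $ i))"
    unfolding q_def by (intro sum.cong refl) (simp add: Av_i flip: sum_distrib_left)
  also have "\<dots> = (\<Sum>i<n. e * complex_of_real ((cmod (v $ i))\<^sup>2))"
    by (intro sum.cong refl) (subst complex_norm_square, simp add: mult_ac)
  also have "\<dots> = e * of_real s"
    by (simp add: s_def sum_distrib_left)
  finally have q: "q = e * of_real s" .
  have "cnj q = (\<Sum>i<n. \<Sum>j<n. cnj (v $ j) * (A $$ (j, i) * v $ i))"
    unfolding q_def cnj_sum
  proof (intro sum.cong refl)
    fix i j assume "i \<in> {..<n}" "j \<in> {..<n}"
    then show "cnj (cnj (v $ i) * (A $$ (i, j) * v $ j)) = cnj (v $ j) * (A $$ (j, i) * v $ i)"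
      using herm[of i j] by (simp add: mult_ac)
  qed
  also have "\<dots> = q"
    unfolding q_def by (rule sum.swap)
  finally have "cnj e * of_real s = e * of_real s"
    using q by (metis complex_cnj_complex_of_real complex_cnj_mult)
  moreover have "s \<noteq> 0"
  proof
    assume "s = 0"
    then have "v $ i = 0" if "i < n" for i
      using that by (auto simp: s_def sum_nonneg_eq_0_iff)
    then have "v = 0\<^sub>v n"
      using v by (intro eq_vecI) auto
    with v show False by simp
  qed
  ultimately show ?thesis
    by (simp add: Reals_cnj_iff)
qed

text \<open>Both sides are the trace of \<open>A * A\<close>: the eigenvalues are real, so their
  squares are the squares of their moduli, and Hermitian symmetry turns
  \<open>A $$ (i, j) * A $$ (j, i)\<close> into a squared modulus.\<close>

lemma hermitian_sum_eigenvalues_squared: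
  fixes A :: "complex mat"
  assumes A: "A \<in> carrier_mat n n" and c: "char_poly A = (\<Prod>e\<leftarrow>es. [:- e, 1:])"
    and herm: "\<And>i j. i < n \<Longrightarrow> j < n \<Longrightarrow> A $$ (j, i) = cnj (A $$ (i, j))"
  shows "(\<Sum>e\<leftarrow>es. (cmod e)\<^sup>2) = (\<Sum>i<n. \<Sum>j<n. (cmod (A $$ (i, j)))\<^sup>2)"
proof -
  have ev: "e \<in> \<real>" if "e \<in> set es" for e
  proof (rule hermitian_eigenvalue_real[OF A herm])
    show "eigenvalue A e"
      unfolding eigenvalue_root_char_poly[OF A] c
      using that by (auto simp: poly_prod_list prod_list_zero_iff)
  qed
  have "(complex_of_real (cmod e))\<^sup>2 = e\<^sup>2" if "e \<in> set es" for e
    using ev[OF that] by (auto elim!: Reals_cases simp flip: of_real_power)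
  then have "complex_of_real (\<Sum>e\<leftarrow>es. (cmod e)\<^sup>2) = (\<Sum>e\<leftarrow>es. e\<^sup>2)"
    by (induction es) auto
  also have "\<dots> = (\<Sum>i<n. (A * A) $$ (i, i))"
    by (rule sum_diag_square_eq_sum_eigenvalues[OF A c, symmetric])
  also have "\<dots> = (\<Sum>i<n. \<Sum>j<n. A $$ (i, j) * A $$ (j, i))"
    using A by (intro sum.cong) (auto simp: scalar_prod_def atLeast0LessThan)
  also have "\<dots> = (\<Sum>i<n. \<Sum>j<n. complex_of_real ((cmod (A $$ (i, j)))\<^sup>2))"
    unfolding complex_norm_square by (intro sum.cong refl) (metis herm lessThan_iff)
  finally show ?thesis
    by (simp only: of_real_sum [symmetric] of_real_eq_iff)
qed

section \<open>Splitting off a zero block\<close>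

lemma char_poly_four_block_diag:
  fixes A B :: "'a :: idom mat"
  assumes A: "A \<in> carrier_mat n n" and B: "B \<in> carrier_mat m m"
  shows "char_poly (four_block_mat A (0\<^sub>m n m) (0\<^sub>m m n) B) = char_poly A * char_poly B"
proof -
  have "char_poly_matrix (four_block_mat A (0\<^sub>m n m) (0\<^sub>m m n) B) =
      four_block_mat (char_poly_matrix A) (0\<^sub>m n m) (0\<^sub>m m n) (char_poly_matrix B)"
    using A B by (intro eq_matI) (auto simp: char_poly_matrix_def)
  then show ?thesis
    unfolding char_poly_def
    using det_four_block_mat_upper_right_zero[of "char_poly_matrix A" n "0\<^sub>m n m" m "0\<^sub>m m n"
        "char_poly_matrix B"] A B
    by simp
qed

lemma char_poly_zero_mat:
  "char_poly (0\<^sub>m m m) = (\<Prod>e\<leftarrow>replicate m (0 :: 'a :: comm_ring_1). [:- e, 1:])"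
proof -
  have "diag_mat (0\<^sub>m m m) = replicate m (0 :: 'a)"
    by (auto simp: diag_mat_def intro: nth_equalityI)
  then show ?thesis
    by (subst char_poly_upper_triangular[of _ m]) auto
qed

subsection \<open>Energy of graphs\<close>

lemma pair_graph_parcs:
  assumes "pair_graph G"
  shows "finite (pverts G)" "parcs G \<subseteq> pverts G \<times> pverts G" "sym (parcs G)" "irrefl (parcs G)"
proof -
  interpret pair_graph G by fact
  show "finite (pverts G)" "parcs G \<subseteq> pverts G \<times> pverts G" "irrefl (parcs G)"
    by (auto simp: irrefl_def dest: in_arcsD1 in_arcsD2 pair_no_loops)
  show "sym (parcs G)"
    using pair_sym_arcs by (simp add: symmetric_def)
qed

lemma pair_graphI:
  assumes "finite (pverts G)" "parcs G \<subseteq> pverts G \<times> pverts G" "sym (parcs G)" "irrefl (parcs G)"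
  shows "pair_graph G"
proof
  show "finite (parcs G)"
    using assms(1,2) finite_subset by blast
qed (use assms in \<open>auto simp: symmetric_def irrefl_def\<close>)

text \<open>All entries are 0 or 1, so the sum counts arcs. In a symmetric graph
  \<open>parcs\<close> contains both directions of an edge, so this is twice the number of
  edges.\<close>

lemma sum_adjacency_mat_squared:
  assumes "distinct xs" "parcs G \<subseteq> set xs \<times> set xs"
  shows "(\<Sum>i<length xs. \<Sum>j<length xs. (cmod (adjacency_mat G xs $$ (i, j)))\<^sup>2) = card (parcs G)"
proof -
  have nth: "bij_betw ((!) xs) {..<length xs} (set xs)"
    using assms(1) by (rule bij_betw_nth) auto
  have "(\<Sum>i<length xs. \<Sum>j<length xs. (cmod (adjacency_mat G xs $$ (i, j)))\<^sup>2) =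
      (\<Sum>i<length xs. \<Sum>j<length xs. if (xs ! i, xs ! j) \<in> parcs G then 1 else 0)"
    by (intro sum.cong refl) (auto simp: adjacency_mat_def)
  also have "\<dots> = (\<Sum>u\<in>set xs. \<Sum>v\<in>set xs. if (u, v) \<in> parcs G then 1 else 0)"
    by (subst sum.reindex_bij_betw[OF nth, symmetric], intro sum.cong refl,
        subst sum.reindex_bij_betw[OF nth, symmetric]) (rule refl)
  also have "\<dots> = (\<Sum>p\<in>set xs \<times> set xs. if p \<in> parcs G then 1 else 0)"
    by (simp add: sum.cartesian_product case_prod_unfold)
  also have "\<dots> = card ((set xs \<times> set xs) \<inter> parcs G)"
    by (subst sum.inter_restrict[symmetric]) auto
  also have "(set xs \<times> set xs) \<inter> parcs G = parcs G"
    using assms(2) by auto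
  finally show ?thesis .
qed

text \<open>By symmetry \<open>Domain (parcs G)\<close> is the set of non-isolated vertices. Listing
  the isolated vertices \<open>ys\<close> last makes the adjacency matrix block diagonal with a zero
  block, which adds only zero eigenvalues; \<open>es\<close> belongs to the other block.\<close>

lemma graph_energy_nonisolated:
  assumes "pair_graph G"
  obtains xs es where "distinct xs" "set xs = Domain (parcs G)"
    "length es = card (Domain (parcs G))"
    "graph_energy G = (\<Sum>e\<leftarrow>es. cmod e)"
    "(\<Sum>e\<leftarrow>es. (cmod e)\<^sup>2) = card (parcs G)"
    "\<And>e. e \<in> set es \<Longrightarrow> eigenvalue (adjacency_mat G xs) e"
proof -
  note G = pair_graph_parcs[OF assms]
  have sub: "Domain (parcs G) \<subseteq> pverts G"
    using G(2) by auto
  obtain xs where xs: "distinct xs" "set xs = Domain (parcs G)"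
    using finite_distinct_list finite_subset[OF sub G(1)] by metis
  obtain ys where ys: "distinct ys" "set ys = pverts G - Domain (parcs G)"
    using finite_distinct_list G(1) by (metis finite_Diff)
  define s where "s = length xs"
  define d where "d = length ys"
  define A where "A = adjacency_mat G xs"
  have A: "A \<in> carrier_mat s s"
    by (simp add: A_def adjacency_mat_def s_def)
  have s: "s = card (Domain (parcs G))"
    using xs distinct_card s_def by metis
  obtain es where es: "char_poly A = (\<Prod>e\<leftarrow>es. [:- e, 1:])" "length es = s"
    using char_poly_factorized[OF A] by auto
  have iso: "(u, v) \<notin> parcs G" "(v, u) \<notin> parcs G" if "v \<in> set ys" for u v
    using that ys(2) G(3) by (auto dest: symD)
  have "adjacency_mat G (xs @ ys) = four_block_mat A (0\<^sub>m s d) (0\<^sub>m d s) (0\<^sub>m d d)"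
    by (rule eq_matI) (auto simp: A_def adjacency_mat_def nth_append iso s_def d_def)
  then have "char_poly (adjacency_mat G (xs @ ys)) = (\<Prod>e\<leftarrow>es @ replicate d 0. [:- e, 1:])"
    using char_poly_four_block_diag[OF A, of "0\<^sub>m d d" d]
    by (simp only: char_poly_zero_mat es(1) map_append prod_list.append zero_carrier_mat simp_thms)
  moreover have "adjacency_mat G (xs @ ys) \<in> carrier_mat (s + d) (s + d)"
    by (simp add: adjacency_mat_def s_def d_def)
  moreover have "graph_energy G = mat_energy (adjacency_mat G (xs @ ys))"
    using xs ys sub by (intro graph_energy_eq) auto
  ultimately have "graph_energy G = (\<Sum>e\<leftarrow>es @ replicate d 0. cmod e)"
    using mat_energy_eq_sum_list by metis
  then have energy: "graph_energy G = (\<Sum>e\<leftarrow>es. cmod e)"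
    by (simp add: sum_list_replicate)
  have "parcs G \<subseteq> set xs \<times> set xs"
    using xs(2) G(3) by (auto dest: symD)
  moreover have "A $$ (j, i) = cnj (A $$ (i, j))" if "i < s" "j < s" for i j
    using that G(3) by (auto simp: A_def adjacency_mat_def s_def dest: symD)
  ultimately have "(\<Sum>e\<leftarrow>es. (cmod e)\<^sup>2) = card (parcs G)"
    using hermitian_sum_eigenvalues_squared[OF A es(1)] sum_adjacency_mat_squared[OF xs(1)]
    unfolding A_def s_def by metis
  moreover have "eigenvalue (adjacency_mat G xs) e" if "e \<in> set es" for e
    using that unfolding A_def[symmetric] eigenvalue_root_char_poly[OF A] es(1)
    by (auto simp: poly_prod_list prod_list_zero_iff)
  ultimately show ?thesis
    using that xs es(2) s energy by metis
qed

text \<open>Charging 1 only for each non-isolated vertex, and not for all \<open>n\<close> vertices,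
  keeps the bound sharp for matchings with isolated vertices.\<close>

lemma graph_energy_le_card:
  assumes "pair_graph G"
  shows "2 * graph_energy G \<le> real (card (Domain (parcs G))) + real (card (parcs G))"
proof -
  obtain xs es where es: "length es = card (Domain (parcs G))"
    "graph_energy G = (\<Sum>e\<leftarrow>es. cmod e)" "(\<Sum>e\<leftarrow>es. (cmod e)\<^sup>2) = card (parcs G)"
    using graph_energy_nonisolated[OF assms] by metis
  have "2 * (\<Sum>e\<leftarrow>es. cmod e) = (\<Sum>e\<leftarrow>es. 2 * cmod e)"
    by (simp add: sum_list_const_mult)
  also have "\<dots> \<le> (\<Sum>e\<leftarrow>es. 1 + (cmod e)\<^sup>2)"
  proof (rule sum_list_mono)
    fix e assume "e \<in> set es"
    show "2 * cmod e \<le> 1 + (cmod e)\<^sup>2"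
      using zero_le_power2[of "cmod e - 1"] by (simp add: power2_diff)
  qed
  also have "\<dots> = length es + (\<Sum>e\<leftarrow>es. (cmod e)\<^sup>2)"
    by (simp add: sum_list_addf sum_list_triv)
  finally show ?thesis
    using es by simp
qed

text \<open>Injectivity of \<open>fst\<close> on the arcs says that every vertex has at most one
  neighbour. Hence the eigenvector equation reads \<open>v $ j = e * v $ i\<close> along an arc, and
  crossing an edge forth and back multiplies a coordinate by the square of \<open>e\<close>.\<close>

lemma adjacency_eigenvalue_matching:
  assumes G: "pair_graph G" and inj: "inj_on fst (parcs G)"
    and xs: "distinct xs" "set xs = Domain (parcs G)"
    and e: "eigenvalue (adjacency_mat G xs) e"
  shows "e\<^sup>2 = 1"
proof -
  define s where "s = length xs"
  have A: "adjacency_mat G xs \<in> carrier_mat s s"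
    by (simp add: adjacency_mat_def s_def)
  from e obtain v where v: "v \<in> carrier_vec s" "v \<noteq> 0\<^sub>v s" and Av: "adjacency_mat G xs *\<^sub>v v = e \<cdot>\<^sub>v v"
    unfolding eigenvalue_def eigenvector_def using A by auto
  have nbr: "v $ j = e * v $ i" if ij: "i < s" "j < s" "(xs ! i, xs ! j) \<in> parcs G" for i j
  proof -
    have uniq: "(xs ! i, xs ! l) \<in> parcs G \<longleftrightarrow> l = j" if "l < s" for l
      using that ij inj_onD[OF inj, of "(xs ! i, xs ! l)" "(xs ! i, xs ! j)"] xs(1)
      by (auto simp: s_def nth_eq_iff_index_eq)
    have "e * v $ i = (\<Sum>l<s. (if (xs ! i, xs ! l) \<in> parcs G then 1 else 0) * v $ l)"
      using arg_cong[OF Av, of "\<lambda>w. w $ i"] ij A v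
      by (simp add: scalar_prod_def atLeast0LessThan adjacency_mat_def s_def)
    also have "\<dots> = (\<Sum>l<s. if l = j then v $ l else 0)"
      by (intro sum.cong) (auto simp: uniq)
    also have "\<dots> = v $ j"
      using ij by simp
    finally show ?thesis by simp
  qed
  \<comment> \<open>A nonzero coordinate; its vertex has a neighbour because \<open>xs\<close> lists
    only non-isolated vertices.\<close>
  obtain i where i: "i < s" "v $ i \<noteq> 0"
    using v by (metis eq_vecI carrier_vecD index_zero_vec)
  then obtain w where w: "(xs ! i, w) \<in> parcs G"
    using xs(2) nth_mem s_def by blast
  then have w': "(w, xs ! i) \<in> parcs G"
    using pair_graph_parcs(3)[OF G] by (auto dest: symD)
  then obtain j where "j < s" "xs ! j = w"
    using xs(2) by (metis DomainI in_set_conv_nth s_def)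
  then have "v $ i = e * (e * v $ i)"
    using nbr[of i j] nbr[of j i] w w' i by simp
  with i show ?thesis
    by (simp add: power2_eq_square)
qed

text \<open>All entries of \<open>es\<close> have modulus 1, so the sum of the moduli equals the
  known sum of their squares.\<close>

lemma graph_energy_matching:
  assumes G: "pair_graph G" and inj: "inj_on fst (parcs G)"
  shows "graph_energy G = card (parcs G)"
proof -
  obtain xs es where xs: "distinct xs" "set xs = Domain (parcs G)"
    and es: "graph_energy G = (\<Sum>e\<leftarrow>es. cmod e)" "(\<Sum>e\<leftarrow>es. (cmod e)\<^sup>2) = card (parcs G)"
      "\<And>e. e \<in> set es \<Longrightarrow> eigenvalue (adjacency_mat G xs) e"
    using graph_energy_nonisolated[OF G] by metis
  have "cmod e = (cmod e)\<^sup>2" if "e \<in> set es" for e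
    using arg_cong[OF adjacency_eigenvalue_matching[OF G inj xs es(3)[OF that]], of cmod]
    by (simp add: norm_power abs_square_eq_1 power2_eq_1_iff)
  then have "(\<Sum>e\<leftarrow>es. cmod e) = (\<Sum>e\<leftarrow>es. (cmod e)\<^sup>2)"
    by (intro arg_cong[where f = sum_list] map_cong refl)
  with es show ?thesis by simp
qed

section \<open>Isomorphisms as vertex maps, and invariance of the energy\<close>

lemma digraph_iso_parcs:
  assumes "digraph_iso (with_proj G) (with_proj H)"
  obtains f where "inj_on f (pverts G)" "pverts H = f ` pverts G" "parcs G \<subseteq> pverts G \<times> pverts G"
    "parcs H = map_prod f f ` parcs G"
proof -
  obtain h where h: "pre_digraph.digraph_isomorphism (with_proj G) h" "with_proj H = app_iso h (with_proj G)"
    using assms unfolding digraph_iso_def by blast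
  \<comment> \<open>The target has the form \<open>with_proj H\<close>, which forces the new tail
    and head maps to be \<open>fst\<close> and \<open>snd\<close>; the arc map is then determined by
    the vertex map.\<close>
  have VH: "pverts H = iso_verts h ` pverts G" and EH: "parcs H = iso_arcs h ` parcs G"
    and ht: "iso_tail h = fst" "iso_head h = snd"
    using h(2) by (auto simp: app_iso_def with_proj_def)
  have wf: "wf_digraph (with_proj G)" and inj: "inj_on (iso_verts h) (pverts G)"
    and ends: "\<And>a. a \<in> parcs G \<Longrightarrow> iso_arcs h a = map_prod (iso_verts h) (iso_verts h) a"
    using h(1) ht unfolding pre_digraph.digraph_isomorphism_def
    by (auto simp: prod_eq_iff)
  have "parcs G \<subseteq> pverts G \<times> pverts G"
    using wf_digraph.tail_in_verts[OF wf] wf_digraph.head_in_verts[OF wf] by fastforce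
  moreover have "parcs H = map_prod (iso_verts h) (iso_verts h) ` parcs G"
    unfolding EH using ends by (metis image_cong)
  ultimately show ?thesis
    using that inj VH by blast
qed

lemma digraph_isoI:
  assumes "inj_on f (pverts G)" "pverts H = f ` pverts G" "parcs G \<subseteq> pverts G \<times> pverts G"
    "parcs H = map_prod f f ` parcs G"
  shows "digraph_iso (with_proj G) (with_proj H)"
proof -
  define h where "h = \<lparr>iso_verts = f, iso_arcs = map_prod f f, iso_head = snd, iso_tail = fst\<rparr>"
  have "inj_on (map_prod f f) (parcs G)"
    using map_prod_inj_on[OF assms(1,1)] assms(3) by (rule inj_on_subset)
  then have "pre_digraph.digraph_isomorphism (with_proj G) h"
    unfolding pre_digraph.digraph_isomorphism_def wf_digraph_def
    using assms(1,3) by (auto simp: h_def)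
  moreover have "with_proj H = app_iso h (with_proj G)"
    using assms(2,4) by (simp add: app_iso_def with_proj_def h_def)
  ultimately show ?thesis
    unfolding digraph_iso_def by blast
qed

text \<open>Listing \<open>H\<close> in the order \<open>map f vs\<close> yields the very adjacency
  matrix that \<open>vs\<close> yields for \<open>G\<close>, and the energy does not depend on the
  listing.\<close>

lemma graph_energy_iso:
  assumes G: "finite (pverts G)" and iso: "digraph_iso (with_proj G) (with_proj H)"
  shows "graph_energy G = graph_energy H"
proof -
  obtain f where f: "inj_on f (pverts G)" "pverts H = f ` pverts G" "parcs G \<subseteq> pverts G \<times> pverts G"
    "parcs H = map_prod f f ` parcs G"
    using digraph_iso_parcs[OF iso] .
  obtain vs where vs: "distinct vs" "set vs = pverts G"
    using finite_distinct_list[OF G] by metis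
  have "(f u, f v) \<in> parcs H \<longleftrightarrow> (u, v) \<in> parcs G" if "u \<in> pverts G" "v \<in> pverts G" for u v
  proof
    assume "(f u, f v) \<in> parcs H"
    then obtain a b where ab: "(a, b) \<in> parcs G" "f a = f u" "f b = f v"
      unfolding f(4) by auto
    then have "a = u" "b = v"
      using that f(3) inj_onD[OF f(1)] by blast+
    with ab show "(u, v) \<in> parcs G"
      by simp
  qed (auto simp: f(4))
  then have "adjacency_mat H (map f vs) = adjacency_mat G vs"
    using vs(2) nth_mem by (intro eq_matI) (fastforce simp: adjacency_mat_def)+
  then show ?thesis
    using graph_energy_eq[OF vs] graph_energy_eq[of "map f vs" H] vs f(1,2)
    by (simp add: distinct_map)
qed

subsection \<open>Components of acyclic graphs\<close>

lemma equiv_reachable: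
  assumes "pair_graph G"
  shows "equiv (pverts G) {(u, v). u \<rightarrow>\<^sup>*\<^bsub>with_proj G\<^esub> v}"
proof -
  interpret pair_graph G by fact
  show ?thesis
  proof (rule equivI)
    show "{(u, v). u \<rightarrow>\<^sup>*\<^bsub>with_proj G\<^esub> v} \<subseteq> pverts G \<times> pverts G"
      by (auto dest: reachable_in_verts)
    show "refl_on (pverts G) {(u, v). u \<rightarrow>\<^sup>*\<^bsub>with_proj G\<^esub> v}"
      by (auto simp: refl_on_def)
    show "sym {(u, v). u \<rightarrow>\<^sup>*\<^bsub>with_proj G\<^esub> v}"
      by (auto intro: symI symmetric_reachable')
    show "trans {(u, v). u \<rightarrow>\<^sup>*\<^bsub>with_proj G\<^esub> v}"
      by (auto intro: transI reachable_trans)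
  qed
qed

text \<open>As classes of an equivalence relation on the vertices, the components of two graphs on
  the same vertex set can be compared through their reachability relations.\<close>

lemma card_sccs_eq_card_quotient:
  assumes G: "pair_graph G"
  shows "card (pre_digraph.sccs (with_proj G)) = card (pverts G // {(u, v). u \<rightarrow>\<^sup>*\<^bsub>with_proj G\<^esub> v})"
proof -
  interpret pair_graph G by fact
  let ?R = "{(u, v). u \<rightarrow>\<^sup>*\<^bsub>with_proj G\<^esub> v}"
  note eq = equiv_reachable[OF G]
  have "sccs_verts = pverts G // ?R"
  proof (rule Set.set_eqI, rule iffI)
    fix S assume S: "S \<in> sccs_verts"
    then obtain x where x: "x \<in> S"
      unfolding sccs_verts_def by auto
    then have "S = ?R `` {x}"
      using S unfolding sccs_verts_def by (auto dest: symmetric_reachable')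
    moreover have "x \<in> pverts G"
      using S x unfolding sccs_verts_def by (auto dest: reachable_in_verts)
    ultimately show "S \<in> pverts G // ?R"
      by (metis quotientI)
  next
    fix S assume "S \<in> pverts G // ?R"
    then obtain x where x: "x \<in> pverts G" and S: "S = {y. x \<rightarrow>\<^sup>*\<^bsub>with_proj G\<^esub> y}"
      by (auto elim: quotientE)
    have "u \<rightarrow>\<^sup>*\<^bsub>with_proj G\<^esub> v" if "u \<in> S" "v \<in> S" for u v
      using that symmetric_reachable'[of x u] reachable_trans[of u x v] by (simp add: S)
    moreover have "\<not> u \<rightarrow>\<^sup>*\<^bsub>with_proj G\<^esub> v" if "u \<in> S" "v \<notin> S" for u v
      using that reachable_trans[of x u v] by (auto simp: S)
    moreover have "x \<in> S"
      using x by (simp add: S)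
    ultimately show "S \<in> sccs_verts"
      unfolding sccs_verts_def by blast
  qed
  then show ?thesis
    using card_sccs_verts by simp
qed

text \<open>Sending each class of \<open>r\<close> to the class of \<open>r'\<close> around it is
  onto, but not injective: a pair in \<open>r'\<close> outside \<open>r\<close> lies in two classes
  of \<open>r\<close> with the same image.\<close>

lemma card_quotient_less:
  assumes V: "finite V" and r: "equiv V r" and r': "equiv V r'" and less: "r \<subset> r'"
  shows "card (V // r') < card (V // r)"
proof -
  have fin: "finite (V // r)"
    using V r by (simp add: quotient_def)
  have img: "r' `` (r `` {x}) = r' `` {x}" if "x \<in> V" for x
    using that less equiv_class_eq[OF r'] equiv_class_self[OF r that] by blast
  have "(\<lambda>C. r' `` C) ` (V // r) = V // r'"
    unfolding quotient_def using img by (auto simp: image_UN)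
  moreover have "\<not> inj_on (\<lambda>C. r' `` C) (V // r)"
  proof
    assume inj: "inj_on (\<lambda>C. r' `` C) (V // r)"
    obtain u v where uv: "(u, v) \<in> r'" "(u, v) \<notin> r"
      using less by auto
    then have V: "u \<in> V" "v \<in> V"
      using equivE[OF r'] by blast+
    have "r' `` (r `` {u}) = r' `` (r `` {v})"
      using img[OF V(1)] img[OF V(2)] equiv_class_eq[OF r' uv(1)] by simp
    then have "r `` {u} = r `` {v}"
      using inj_onD[OF inj] V by (simp add: quotientI)
    then show False
      using uv(2) eq_equiv_class[OF _ r V(2)] by blast
  qed
  ultimately show ?thesis
    using card_image_le[OF fin] eq_card_imp_inj_on[OF fin] by (metis order_le_imp_less_or_eq)
qed

text \<open>
  By induction on the edges: deleting an edge of an acyclic graph separates its end points, since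
  a path joining them would close up to a cycle; hence the number of components increases.
\<close>

lemma acyclic_card_parcs_le:
  assumes "pair_graph G" and "acyclic_graph G"
  shows "card (parcs G) + 2 * card (pre_digraph.sccs (with_proj G)) \<le> 2 * card (pverts G)"
  using assms
\<comment> \<open>The inequality is "edges plus components at most vertices", doubled because
  \<open>parcs\<close> counts each edge twice.\<close>
proof (induction "card (parcs G)" arbitrary: G rule: less_induct)
  case less
  note G = pair_graph_parcs[OF less.prems(1)]
  interpret G: pair_graph G by fact
  let ?R = "{(u, v). u \<rightarrow>\<^sup>*\<^bsub>with_proj G\<^esub> v}"
  have fin: "finite (parcs G)"
    by (rule G.pair_finite_arcs)
  show ?case
  proof (cases "parcs G = {}")
    case True
    have "pverts G // ?R = (\<lambda>x. ?R `` {x}) ` pverts G"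
      by (auto simp: quotient_def)
    then have "card (pverts G // ?R) \<le> card (pverts G)"
      using card_image_le[OF G(1)] by simp
    with True show ?thesis
      unfolding card_sccs_eq_card_quotient[OF less.prems(1)] by simp
  next
    case False
    then obtain u v where uv: "(u, v) \<in> parcs G"
      by auto
    then have vu: "(v, u) \<in> parcs G" and neq: "u \<noteq> v"
      using G by (auto simp: irrefl_def dest: symD)
    \<comment> \<open>Both directions are deleted to keep the graph symmetric.\<close>
    define H where "H = \<lparr>pverts = pverts G, parcs = parcs G - {(u, v), (v, u)}\<rparr>"
    have VH: "pverts H = pverts G" and EH: "parcs H = parcs G - {(u, v), (v, u)}"
      by (auto simp: H_def)
    have H: "pair_graph H"
      using G by (intro pair_graphI) (auto simp: VH EH irrefl_def sym_def)
    interpret H: pair_graph H by fact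
    let ?R' = "{(u, v). u \<rightarrow>\<^sup>*\<^bsub>with_proj H\<^esub> v}"
    have card: "card (parcs G) = card (parcs H) + 2"
      using uv vu neq fin card_mono[OF fin, of "{(u, v), (v, u)}"]
      by (simp add: EH card_Diff_subset)
    \<comment> \<open>Needed twice: to inherit acyclicity, and to close a path of \<open>H\<close>
      to a cycle of \<open>G\<close>.\<close>
    have walk: "G.awalk x p y" if "H.awalk x p y" for x p y
      using that by (auto simp: G.awalk_def H.awalk_def VH EH)
    have "acyclic_graph H"
      using less.prems(2) walk unfolding acyclic_graph_def G.cycle_def H.cycle_def by blast
    with less.hyps[OF _ H] card have IH:
      "card (parcs H) + 2 * card (pverts G // ?R') \<le> 2 * card (pverts G)"
      by (simp add: card_sccs_eq_card_quotient[OF H] VH)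
    have "\<not> u \<rightarrow>\<^sup>*\<^bsub>with_proj H\<^esub> v"
    proof
      assume "u \<rightarrow>\<^sup>*\<^bsub>with_proj H\<^esub> v"
      then obtain p where p: "H.apath u p v"
        by (metis H.reachable_awalk H.apath_awalk_to_apath)
      then have pw: "H.awalk u p v" and dist: "distinct (pawalk_verts u p)"
        by (auto simp: H.apath_def)
      \<comment> \<open>The path is not empty since \<open>u \<noteq> v\<close>, and not a single
        arc since \<open>(u, v)\<close> was deleted. With \<open>(v, u)\<close> in front, the cycle
        thus has the length at least 3 that \<open>acyclic_graph\<close> excludes.\<close>
      have "p \<noteq> []"
        using pw neq by (auto simp: H.awalk_Nil_iff)
      moreover have "p \<noteq> [e]" for e
        using pw by (cases e) (auto simp: H.awalk_Cons_iff H.awalk_Nil_iff EH)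
      ultimately have "2 \<le> length p"
        by (cases p; cases "tl p") auto
      moreover have "G.cycle ((v, u) # p)"
        unfolding G.cycle_def using walk[OF pw] vu dist by (auto simp: G.awalk_Cons_iff)
      ultimately show False
        using less.prems(2) unfolding acyclic_graph_def by force
    qed
    moreover have "u \<rightarrow>\<^sup>*\<^bsub>with_proj G\<^esub> v"
      using uv by simp
    moreover have "?R' \<subseteq> ?R"
      using rtrancl_on_mono[of "parcs H" "parcs G" "pverts G" "pverts G"]
      by (auto simp: reachable_def VH EH)
    ultimately have "?R' \<subset> ?R"
      by blast
    then have "card (pverts G // ?R) < card (pverts G // ?R')"
      using card_quotient_less[OF G(1)] equiv_reachable[OF H] equiv_reachable[OF less.prems(1)] VH
      by simp
    with IH card show ?thesis
      unfolding card_sccs_eq_card_quotient[OF less.prems(1)] by simp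
  qed
qed

subsection \<open>Graphs of maximum degree one\<close>

text \<open>After \<open>b\<close> a walk can only return along the reversed arc, so the third arc
  \<open>c\<close> leads back to \<open>fst b\<close>, a repetition that a cycle of length at least
  3 does not allow.\<close>

lemma acyclic_graph_matching:
  assumes G: "pair_graph G" and inj: "inj_on fst (parcs G)"
  shows "acyclic_graph G"
  unfolding acyclic_graph_def
proof
  interpret pair_graph G by fact
  assume "\<exists>p. cycle p \<and> 3 \<le> length p"
  then obtain p u where p: "awalk u p u" "distinct (tl (pawalk_verts u p))" "3 \<le> length p"
    unfolding cycle_def by auto
  from p(3) obtain a b c q where p_eq: "p = a # b # c # q"
    by (metis Suc_le_length_iff numeral_3_eq_3)
  have ab: "a \<in> parcs G" "b \<in> parcs G" "c \<in> parcs G" "snd a = fst b" "snd b = fst c"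
    using p(1) unfolding p_eq by (auto simp: awalk_Cons_iff)
  have "(snd b, fst b) \<in> parcs G"
    using ab(2) pair_graph_parcs(3)[OF G] by (metis prod.collapse symD)
  then have "c = (snd b, fst b)"
    using ab(3,5) inj by (metis fst_conv inj_onD)
  then have "snd c = fst b"
    by simp
  \<comment> \<open>Both are entries of the vertex list after its head, which are distinct; this
    includes the case that \<open>c\<close> closes the cycle.\<close>
  moreover have "fst b \<noteq> snd c"
    using p(1,2) ab unfolding p_eq by (cases q) (auto simp: awalk_Cons_iff)
  ultimately show False
    by simp
qed

section \<open>The forest \<open>matching_forest n k\<close>: first ends, second ends and isolated
  vertices\<close>

lemma pverts_matching_forest:
  "pverts (matching_forest n k) =
    (\<lambda>i. (i, 0)) ` {..<n - k} \<union> (\<lambda>i. (i, 1)) ` {..<n - k} \<union>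
    (\<lambda>i. (i, 0)) ` {n - k..<(n - k) + (2 * k - n)}"
  unfolding matching_forest_def disjoint_union_graph_def path_graph_def
  by (auto split: if_splits simp: image_iff less_Suc_eq numeral_2_eq_2)

lemma parcs_matching_forest:
  "parcs (matching_forest n k) =
    (\<lambda>i. ((i, 0), (i, 1))) ` {..<n - k} \<union> (\<lambda>i. ((i, 1), (i, 0))) ` {..<n - k}"
proof (rule Set.set_eqI)
  fix e :: "(nat \<times> nat) \<times> nat \<times> nat"
  obtain i u j v where "e = ((i, u), (j, v))"
    by (metis prod.collapse)
  then show "e \<in> parcs (matching_forest n k) \<longleftrightarrow>
      e \<in> (\<lambda>i. ((i, 0), (i, 1))) ` {..<n - k} \<union> (\<lambda>i. ((i, 1), (i, 0))) ` {..<n - k}"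
    unfolding matching_forest_def disjoint_union_graph_def path_graph_def
    by (auto split: if_splits simp: image_iff less_Suc_eq numeral_2_eq_2)
qed

lemma inj_on_fst_matching_forest: "inj_on fst (parcs (matching_forest n k))"
  unfolding parcs_matching_forest by (auto simp: inj_on_def)

lemma card_parcs_matching_forest: "card (parcs (matching_forest n k)) = 2 * (n - k)"
  unfolding parcs_matching_forest by (subst card_Un_disjoint) (auto simp: card_image inj_on_def)

lemma pair_graph_matching_forest: "pair_graph (matching_forest n k)"
proof (rule pair_graphI)
  show "finite (pverts (matching_forest n k))"
    by (simp add: pverts_matching_forest)
  show "parcs (matching_forest n k) \<subseteq> pverts (matching_forest n k) \<times> pverts (matching_forest n k)"
    unfolding pverts_matching_forest parcs_matching_forest by auto
  show "sym (parcs (matching_forest n k))"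
    unfolding parcs_matching_forest by (auto simp: sym_def)
  show "irrefl (parcs (matching_forest n k))"
    unfolding parcs_matching_forest by (auto simp: irrefl_def)
qed

lemma card_pverts_matching_forest:
  assumes "k \<le> n" "n \<le> 2 * k"
  shows "card (pverts (matching_forest n k)) = n"
proof -
  let ?A = "(\<lambda>i. (i, 0 :: nat)) ` {..<n - k}" and ?B = "(\<lambda>i. (i, 1 :: nat)) ` {..<n - k}"
    and ?C = "(\<lambda>i. (i, 0 :: nat)) ` {n - k..<(n - k) + (2 * k - n)}"
  have "card (pverts (matching_forest n k)) = card (?A \<union> ?B) + card ?C"
    unfolding pverts_matching_forest by (rule card_Un_disjoint) auto
  also have "card (?A \<union> ?B) = card ?A + card ?B"
    by (rule card_Un_disjoint) auto
  finally show ?thesis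
    using assms by (simp add: card_image inj_on_def)
qed

text \<open>Reachability means lying in the same copy, so components correspond to first
  coordinates. Under the hypotheses the truncated differences \<open>n - k\<close> and
  \<open>2 * k - n\<close> add up to \<open>k\<close>.\<close>

lemma card_sccs_matching_forest:
  assumes "k \<le> n" "n \<le> 2 * k"
  shows "card (pre_digraph.sccs (with_proj (matching_forest n k))) = k"
proof -
  let ?M = "matching_forest n k"
  interpret pair_graph ?M
    by (rule pair_graph_matching_forest)
  have reach: "x \<rightarrow>\<^sup>*\<^bsub>with_proj ?M\<^esub> y \<longleftrightarrow> fst x = fst y" if V: "x \<in> pverts ?M" "y \<in> pverts ?M" for x y
  proof
    assume "x \<rightarrow>\<^sup>*\<^bsub>with_proj ?M\<^esub> y"
    then show "fst x = fst y"
    proof (induction rule: converse_reachable_induct)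
      case (step x z)
      then have "(x, z) \<in> parcs ?M"
        by simp
      then have "fst x = fst z"
        unfolding parcs_matching_forest by auto
      with step show ?case by simp
    qed simp
  next
    assume "fst x = fst y"
    then have "x = y \<or> (x, y) \<in> parcs ?M"
      using V unfolding pverts_matching_forest parcs_matching_forest by auto
    then show "x \<rightarrow>\<^sup>*\<^bsub>with_proj ?M\<^esub> y"
      using V by auto
  qed
  have fst: "fst ` pverts ?M = {..<k}"
    unfolding pverts_matching_forest image_Un image_image using assms by auto
  have "{(u, v). u \<rightarrow>\<^sup>*\<^bsub>with_proj ?M\<^esub> v} `` {x} = {y \<in> pverts ?M. fst x = fst y}"
    if "x \<in> pverts ?M" for x
    using that reach reachable_in_verts(2) unfolding Image_singleton by blast
  then have "pverts ?M // {(u, v). u \<rightarrow>\<^sup>*\<^bsub>with_proj ?M\<^esub> v} =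
      (\<lambda>x. {y \<in> pverts ?M. fst x = fst y}) ` pverts ?M"
    unfolding quotient_def by auto
  also have "\<dots> = (\<lambda>i. {y \<in> pverts ?M. i = fst y}) ` {..<k}"
    unfolding fst[symmetric] by (simp add: image_image)
  finally have "card (pverts ?M // {(u, v). u \<rightarrow>\<^sup>*\<^bsub>with_proj ?M\<^esub> v}) =
      card ((\<lambda>i. {y \<in> pverts ?M. i = fst y}) ` {..<k})"
    by simp
  also have "\<dots> = k"
  proof (subst card_image)
    \<comment> \<open>Every index below \<open>k\<close> occurs as a first coordinate, so the sets
      are nonempty and hence distinct.\<close>
    show "inj_on (\<lambda>i. {y \<in> pverts ?M. i = fst y}) {..<k}"
      unfolding fst[symmetric] by (rule inj_onI) blast
  qed simp
  finally show ?thesis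
    using card_sccs_eq_card_quotient[OF pair_graph_matching_forest] by simp
qed

lemma matching_forest_in_forests:
  assumes "k \<le> n" "n \<le> 2 * k"
  shows "matching_forest n k \<in> forests n k"
  unfolding forests_def
  using assms pair_graph_matching_forest inj_on_fst_matching_forest
  by (simp add: acyclic_graph_matching card_pverts_matching_forest card_sccs_matching_forest)

text \<open>
  Non-isolated vertices are paired with their unique neighbour \<open>p v\<close>; \<open>T\<close> picks one end point of each edge.
\<close>

lemma digraph_iso_matching_forest:
  fixes G :: "'a pair_pre_digraph"
  assumes G: "pair_graph G" and inj: "inj_on fst (parcs G)"
    and E: "card (parcs G) = 2 * (n - k)" and V: "card (pverts G) = n" and k: "k \<le> n" "n \<le> 2 * k"
  shows "digraph_iso (with_proj G) (with_proj (matching_forest n k))"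
proof -
  note G = pair_graph_parcs[OF G]
  define S where "S = Domain (parcs G)"
  define p where "p v = (THE w. (v, w) \<in> parcs G)" for v
  have "w' = w" if "(v, w) \<in> parcs G" "(v, w') \<in> parcs G" for v w w'
    using inj_onD[OF inj _ that] by simp
  then have p: "w = p v" if "(v, w) \<in> parcs G" for v w
    unfolding p_def using that by (intro the_equality[symmetric])
  have pE: "(v, p v) \<in> parcs G" if "v \<in> S" for v
    using that p unfolding S_def by auto
  have pE': "(p v, v) \<in> parcs G" if "v \<in> S" for v
    using pE[OF that] G(3) by (auto dest: symD)
  have pS: "p v \<in> S" if "v \<in> S" for v
    using pE'[OF that] by (auto simp: S_def)
  have pp: "p (p v) = v" if "v \<in> S" for v
    using p[OF pE'[OF that]] by simp
  have pne: "p v \<noteq> v" if "v \<in> S" for v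
    using pE[OF that] G(4) unfolding irrefl_def by metis
  have SV: "S \<subseteq> pverts G"
    using G(2) by (auto simp: S_def)
  have finS: "finite S"
    using SV G(1) finite_subset by blast
  \<comment> \<open>The choice depends only on the set of the two end points, so both ends of an
    edge agree on it.\<close>
  define r where "r e = (SOME x. x \<in> e)" for e :: "'a set"
  define T where "T = {v \<in> S. r {v, p v} = v}"
  have TS: "T \<subseteq> S"
    by (auto simp: T_def)
  have T_iff: "p v \<in> T \<longleftrightarrow> v \<notin> T" if "v \<in> S" for v
  proof -
    have "r {v, p v} = v \<or> r {v, p v} = p v"
      unfolding r_def using someI[of "\<lambda>x. x \<in> {v, p v}" v] by simp
    moreover have "{p v, p (p v)} = {v, p v}"
      using pp[OF that] by auto
    ultimately show ?thesis
      using that pS[OF that] pne[OF that] unfolding T_def by auto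
  qed
  have S_eq: "S = T \<union> p ` T" and disj: "T \<inter> p ` T = {}"
  proof -
    have "v \<in> p ` T" if "v \<in> S" "v \<notin> T" for v
      using that T_iff pp by (metis image_eqI)
    then show "S = T \<union> p ` T"
      using TS pS by auto
    show "T \<inter> p ` T = {}"
      using T_iff TS by auto
  qed
  have inj_p: "inj_on p T"
    using pp TS by (metis inj_onI subsetD)
  have "card S = card (parcs G)"
    using card_image[OF inj] by (simp add: S_def Domain_fst)
  moreover have "card S = 2 * card T"
    using disj finS S_eq inj_p by (metis card_Un_disjoint card_image finite_Un mult_2)
  ultimately have cT: "card T = n - k" and cS: "card S = 2 * (n - k)"
    using E by auto
  then obtain g where g: "bij_betw g T {..<n - k}"
    using finite_subset[OF TS finS] by (metis card_lessThan finite_lessThan finite_same_card_bij)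
  have "card (pverts G - S) = card {n - k..<(n - k) + (2 * k - n)}"
    using SV finS cS V k by (simp add: card_Diff_subset)
  then obtain h where h: "bij_betw h (pverts G - S) {n - k..<(n - k) + (2 * k - n)}"
    using G(1) by (metis finite_Diff finite_atLeastLessThan finite_same_card_bij)
  \<comment> \<open>\<open>g\<close> numbers the edges through their ends in \<open>T\<close>, and
    \<open>h\<close> the isolated vertices. The end in \<open>T\<close> becomes vertex 0 of its copy
    of \<open>P_2\<close>, its partner vertex 1.\<close>
  define f where "f v = (if v \<in> T then (g v, 0 :: nat) else if v \<in> S then (g (p v), 1) else (h v, 0))" for v
  have fT: "f v = (g v, 0)" and fpT: "f (p v) = (g v, 1)" if "v \<in> T" for v
    using that T_iff[of v] TS pS[of v] pp[of v] by (auto simp: f_def)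
  have fI: "f v = (h v, 0)" if "v \<in> pverts G - S" for v
    using that TS by (auto simp: f_def)
  have V_eq: "pverts G = T \<union> p ` T \<union> (pverts G - S)"
    using S_eq SV by auto
  have imT: "f ` T = (\<lambda>i. (i, 0)) ` {..<n - k}" and impT: "f ` p ` T = (\<lambda>i. (i, 1)) ` {..<n - k}"
    unfolding bij_betw_imp_surj_on[OF g, symmetric] image_image using fT fpT by (auto intro!: image_cong)
  have imI: "f ` (pverts G - S) = (\<lambda>i. (i, 0)) ` {n - k..<(n - k) + (2 * k - n)}"
    unfolding bij_betw_imp_surj_on[OF h, symmetric] image_image using fI by (intro image_cong) auto
  have im: "pverts (matching_forest n k) = f ` pverts G"
    unfolding pverts_matching_forest using imT impT imI V_eq by (metis image_Un)
  show ?thesis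
  proof (rule digraph_isoI)
    show "pverts (matching_forest n k) = f ` pverts G"
      by (rule im)
    \<comment> \<open>The image is the vertex set of the matching forest, which also has
      \<open>n\<close> elements; a map onto a finite set of equal size is injective.\<close>
    show "inj_on f (pverts G)"
      using im card_pverts_matching_forest[OF k] V G(1) by (intro eq_card_imp_inj_on) simp_all
    show "parcs G \<subseteq> pverts G \<times> pverts G"
      by (rule G(2))
    have "parcs G = (\<lambda>v. (v, p v)) ` S"
    proof
      show "parcs G \<subseteq> (\<lambda>v. (v, p v)) ` S"
        using p unfolding S_def by fast
      show "(\<lambda>v. (v, p v)) ` S \<subseteq> parcs G"
        using pE by blast
    qed
    \<comment> \<open>The arcs leaving \<open>T\<close> and their reversals, since \<open>p\<close>
      undoes itself on \<open>S\<close>.\<close>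
    also have "\<dots> = (\<lambda>v. (v, p v)) ` T \<union> (\<lambda>v. (p v, v)) ` T"
      unfolding S_eq image_Un image_image using pp TS
      by (intro arg_cong2[where f = "(\<union>)"] image_cong) auto
    finally have "map_prod f f ` parcs G =
        (\<lambda>v. (f v, f (p v))) ` T \<union> (\<lambda>v. (f (p v), f v)) ` T"
      by (simp add: image_Un image_image)
    also have "\<dots> = (\<lambda>v. ((g v, 0), (g v, 1))) ` T \<union> (\<lambda>v. ((g v, 1), (g v, 0))) ` T"
      using fT fpT by (intro arg_cong2[where f = "(\<union>)"] image_cong) auto
    also have "\<dots> = parcs (matching_forest n k)"
      unfolding parcs_matching_forest bij_betw_imp_surj_on[OF g, symmetric] image_image ..
    finally show "parcs (matching_forest n k) = map_prod f f ` parcs G"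
      by simp
  qed
qed

theorem theorem9:
  fixes n k :: nat
  assumes "1 \<le> k" and "k \<le> n" and "n \<le> 2 * k"
  shows "matching_forest n k \<in> forests n k \<and>
    graph_energy (matching_forest n k) = 2 * (real n - real k) \<and>
    (\<forall>G :: 'a pair_pre_digraph. G \<in> forests n k \<longrightarrow>
      graph_energy G \<le> graph_energy (matching_forest n k) \<and>
      (graph_energy G = graph_energy (matching_forest n k) \<longleftrightarrow>
        digraph_iso (with_proj G) (with_proj (matching_forest n k))))"
proof (intro conjI allI impI)
  show "matching_forest n k \<in> forests n k"
    using assms by (intro matching_forest_in_forests)
  show energy: "graph_energy (matching_forest n k) = 2 * (real n - real k)"
    using graph_energy_matching[OF pair_graph_matching_forest inj_on_fst_matching_forest] assms
    by (simp add: card_parcs_matching_forest of_nat_diff)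
  fix G :: "'a pair_pre_digraph"
  assume "G \<in> forests n k"
  then have G: "pair_graph G" "acyclic_graph G" "card (pverts G) = n"
    "card (pre_digraph.sccs (with_proj G)) = k"
    by (auto simp: forests_def)
  have fin: "finite (parcs G)"
    using pair_graph_parcs(1,2)[OF G(1)] finite_subset by blast
  have E: "card (parcs G) \<le> 2 * (n - k)"
    using acyclic_card_parcs_le[OF G(1,2)] G(3,4) by simp
  have S: "card (fst ` parcs G) \<le> card (parcs G)"
    by (rule card_image_le[OF fin])
  have bound: "2 * graph_energy G \<le> real (card (fst ` parcs G)) + real (card (parcs G))"
    using graph_energy_le_card[OF G(1)] by (simp add: Domain_fst)
  have M: "graph_energy (matching_forest n k) = real (2 * (n - k))"
    using energy assms by simp
  show "graph_energy G \<le> graph_energy (matching_forest n k)"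
    using bound E S M by linarith
  show "graph_energy G = graph_energy (matching_forest n k) \<longleftrightarrow>
      digraph_iso (with_proj G) (with_proj (matching_forest n k))"
  proof
    assume "graph_energy G = graph_energy (matching_forest n k)"
    \<comment> \<open>Equal energies leave no slack in \<open>bound\<close>, \<open>S\<close> and
      \<open>E\<close>. Equality in \<open>S\<close> makes \<open>fst\<close> injective on the arcs,
      that is, all degrees are at most one.\<close>
    then have card: "card (parcs G) = 2 * (n - k)" "card (fst ` parcs G) = card (parcs G)"
      using bound E S M by linarith+
    then have "inj_on fst (parcs G)"
      using fin eq_card_imp_inj_on by blast
    then show "digraph_iso (with_proj G) (with_proj (matching_forest n k))"
      using digraph_iso_matching_forest G(1,3) card(1) assms by blast
  next
    assume "digraph_iso (with_proj G) (with_proj (matching_forest n k))"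
    then show "graph_energy G = graph_energy (matching_forest n k)"
      using graph_energy_iso pair_graph_parcs(1)[OF G(1)] by blast
  qed
qed

end
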